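(* Let $N\ge 1$ and $K\ge 2$ be integers and let $\tau>0$. Define matrices $\vartheta,\theta\in\mathbb{R}^{N\times K}$ by $$\vartheta_{n,k}=3^{\left(2^{(n-1)K+k}N\tau\right)},\qquad \theta_{n,k}=\frac{\vartheta_{n,k}}{\sum_{j=1}^K\vartheta_{n,j}},\qquad n\in\{1,\dots,N\},\ k\in\{1,\dots,K\}.$$ Then the $K$-ary cross-entropy loss $\mathrm{CEloss}$ is $2\tau$-codomain separable using $\theta$. If instead (case $\tau=0$) one takes $\vartheta_{n,k}=3^{\left(2^{(n-1)K+k}\right)}$ and the same normalization $\theta_{n,k}=\vartheta_{n,k}/\sum_{j=1}^K\vartheta_{n,j}$, then $\mathrm{CEloss}$ is $0^+$-codomain separable using $\theta$.
   Context: Label classes are indexed by $\{1,\dots,K\}$. For a labeling $\sigma\in\{1,\dots,K\}^N$ and a matrix $\theta\in(0,1)^{N\times K}$ whose rows each sum to $1$, $$\mathrm{CEloss}(\sigma,\theta):=-\frac1N\sum_{i=1}^N\sum_{k=1}^{K}[\sigma_i=k]\,\ln\theta_{i,k},$$ where $[\sigma_i=k]$ equals $1$ if $\sigma_i=k$ and $0$ otherwise. For fixed $\theta$, let $\Lambda_\theta(\mathrm{CEloss}):=\min_{\sigma_1\ne\sigma_2}|\mathrm{CEloss}(\sigma_1,\theta)-\mathrm{CEloss}(\sigma_2,\theta)|$ over distinct labelings $\sigma_1,\sigma_2\in\{1,\dots,K\}^N$. For $t>0$, $\mathrm{CEloss}$ is $t$-codomain separable using $\theta$ if $\Lambda_\theta(\mathrm{CEloss})\ge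 t$, and $0^+$-codomain separable using $\theta$ if $\Lambda_\theta(\mathrm{CEloss})>0$. *)

theory Defs
  imports Complex_Main "HOL-Library.FuncSet"
begin

text \<open>
  An \<open>N \<times> K\<close> matrix is a function on indices; only the entries with
  \<open>i \<in> {1..N}\<close> and \<open>k \<in> {1..K}\<close> matter. Labelings are extensional functions, so that two of
  them are distinct exactly if they differ at some \<open>i \<in> {1..N}\<close>.
\<close>

definition labelings :: "nat \<Rightarrow> nat \<Rightarrow> (nat \<Rightarrow> nat) set" where
  "labelings N K = {1..N} \<rightarrow>\<^sub>E {1..K}"

definition prob_matrices :: "nat \<Rightarrow> nat \<Rightarrow> (nat \<Rightarrow> nat \<Rightarrow> real) set" where
  "prob_matrices N K = {\<theta>. (\<forall>i\<in>{1..N}. \<forall>k\<in>{1..K}. 0 < \<theta> i k \<and> \<theta> i k < 1) \<and>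
                           (\<forall>i\<in>{1..N}. (\<Sum>k=1..K. \<theta> i k) = 1)}"

definition CEloss :: "nat \<Rightarrow> nat \<Rightarrow> (nat \<Rightarrow> nat) \<Rightarrow> (nat \<Rightarrow> nat \<Rightarrow> real) \<Rightarrow> real" where
  "CEloss N K \<sigma> \<theta> =
     - (1 / real N) * (\<Sum>i=1..N. \<Sum>k=1..K. of_bool (\<sigma> i = k) * ln (\<theta> i k))"

text \<open>
  The set below is finite, and it is nonempty if \<open>N \<ge> 1\<close> and \<open>K \<ge> 2\<close>; only then is
  the minimum meaningful.
\<close>

definition min_gap ::
    "nat \<Rightarrow> nat \<Rightarrow> ((nat \<Rightarrow> nat) \<Rightarrow> (nat \<Rightarrow> nat \<Rightarrow> real) \<Rightarrow> real) \<Rightarrow> (nat \<Rightarrow> nat \<Rightarrow> real) \<Rightarrow> real" where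
  "min_gap N K f \<theta> =
     Min {\<bar>f \<sigma>\<^sub>1 \<theta> - f \<sigma>\<^sub>2 \<theta>\<bar> | \<sigma>\<^sub>1 \<sigma>\<^sub>2.
            \<sigma>\<^sub>1 \<in> labelings N K \<and> \<sigma>\<^sub>2 \<in> labelings N K \<and> \<sigma>\<^sub>1 \<noteq> \<sigma>\<^sub>2}"

text \<open>
  Losses are total functions here, so the two separability predicates carry the requirement
  that \<open>\<theta>\<close> lies in the domain of the loss.
\<close>

definition codomain_separable ::
    "real \<Rightarrow> nat \<Rightarrow> nat \<Rightarrow> ((nat \<Rightarrow> nat) \<Rightarrow> (nat \<Rightarrow> nat \<Rightarrow> real) \<Rightarrow> real) \<Rightarrow> (nat \<Rightarrow> nat \<Rightarrow> real) \<Rightarrow> bool" where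
  "codomain_separable t N K f \<theta> \<longleftrightarrow>
     t > 0 \<and> \<theta> \<in> prob_matrices N K \<and> min_gap N K f \<theta> \<ge> t"

definition zero_plus_codomain_separable ::
    "nat \<Rightarrow> nat \<Rightarrow> ((nat \<Rightarrow> nat) \<Rightarrow> (nat \<Rightarrow> nat \<Rightarrow> real) \<Rightarrow> real) \<Rightarrow> (nat \<Rightarrow> nat \<Rightarrow> real) \<Rightarrow> bool" where
  "zero_plus_codomain_separable N K f \<theta> \<longleftrightarrow>
     \<theta> \<in> prob_matrices N K \<and> min_gap N K f \<theta> > 0"

definition row_normalize :: "nat \<Rightarrow> (nat \<Rightarrow> nat \<Rightarrow> real) \<Rightarrow> (nat \<Rightarrow> nat \<Rightarrow> real)" where
  "row_normalize K v n k = v n k / (\<Sum>j=1..K. v n j)"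

end

theory Submission
  imports Defs "HOL-Library.Nat_Bijection"
begin

text \<open>
  In the difference of two losses the row normalizations cancel, and up to the factor
  \<open>c ln 3 / N\<close> there remains a difference of two sums of powers of two with exponents
  \<open>(i - 1) K + \<sigma> i \<ge> 1\<close>. These exponents determine \<open>i\<close> and \<open>\<sigma> i\<close> (base \<open>K\<close> with digits
  \<open>1..K\<close>), so by uniqueness of binary representation different labelings give different sums;
  being even integers, they differ by at least \<open>2\<close>. Finally \<open>ln 3 \<ge> 1\<close>.
\<close>

definition code_exponent :: "nat \<Rightarrow> nat \<Rightarrow> nat \<Rightarrow> nat" where
  "code_exponent K i k = (i - 1) * K + k"

definition labeling_code :: "nat \<Rightarrow> nat \<Rightarrow> (nat \<Rightarrow> nat) \<Rightarrow> nat" where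
  "labeling_code N K \<sigma> = (\<Sum>i=1..N. 2 ^ code_exponent K i (\<sigma> i))"

lemma code_exponent_inject:
  assumes "1 \<le> i" "1 \<le> j" "k \<in> {1..K}" "l \<in> {1..K}"
    and eq: "code_exponent K i k = code_exponent K j l"
  shows "i = j \<and> k = l"
proof -
  \<comment> \<open>Subtracting 1 shifts the digits from 1..K to the usual range 0..K-1, so that
    division by \<open>K\<close> recovers the row.\<close>
  have quot: "((m - 1) * K + n - 1) div K = m - 1" if "n \<in> {1..K}" for m n
  proof -
    have "(m - 1) * K + n - 1 = (n - 1) + (m - 1) * K" "n - 1 < K" "K \<noteq> 0"
      using that by auto
    then show ?thesis by simp
  qed
  have "i - 1 = j - 1"
    using quot[of k i] quot[of l j] assms unfolding code_exponent_def by simp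
  with assms show ?thesis
    by (auto simp: code_exponent_def)
qed

text \<open>Distinct rows contribute distinct exponents, so no power of two is repeated and the sum
  over rows is a sum over the set of exponents. This makes the injectivity of
  \<open>set_encode\<close> on finite sets available.\<close>

lemma labeling_code_eq_set_encode:
  assumes "\<sigma> \<in> labelings N K"
  shows "labeling_code N K \<sigma> = set_encode ((\<lambda>i. code_exponent K i (\<sigma> i)) ` {1..N})"
proof -
  have "inj_on (\<lambda>i. code_exponent K i (\<sigma> i)) {1..N}"
  proof (rule inj_onI)
    fix i j assume "i \<in> {1..N}" "j \<in> {1..N}"
      "code_exponent K i (\<sigma> i) = code_exponent K j (\<sigma> j)"
    with assms show "i = j"
      using code_exponent_inject[of i j "\<sigma> i" K "\<sigma> j"] by (auto simp: labelings_def PiE_iff)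
  qed
  then show ?thesis
    by (simp add: labeling_code_def set_encode_def sum.reindex)
qed

lemma inj_on_labeling_code: "inj_on (labeling_code N K) (labelings N K)"
proof (rule inj_onI)
  fix \<sigma> \<rho>
  assume \<sigma>: "\<sigma> \<in> labelings N K" and \<rho>: "\<rho> \<in> labelings N K"
    and "labeling_code N K \<sigma> = labeling_code N K \<rho>"
  then have img: "(\<lambda>i. code_exponent K i (\<sigma> i)) ` {1..N} = (\<lambda>i. code_exponent K i (\<rho> i)) ` {1..N}"
    by (simp add: labeling_code_eq_set_encode set_encode_eq)
  show "\<sigma> = \<rho>"
  proof (rule PiE_ext)
    show "\<sigma> \<in> {1..N} \<rightarrow>\<^sub>E {1..K}" "\<rho> \<in> {1..N} \<rightarrow>\<^sub>E {1..K}"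
      using \<sigma> \<rho> by (simp_all add: labelings_def)
    fix i assume i: "i \<in> {1..N}"
    then have "code_exponent K i (\<sigma> i) \<in> (\<lambda>i. code_exponent K i (\<rho> i)) ` {1..N}"
      unfolding img[symmetric] by (rule imageI)
    \<comment> \<open>Equality of the exponent sets only yields a match in some row
      \<open>j\<close>; \<open>code_exponent_inject\<close> then forces
      \<open>j = i\<close>.\<close>
    then obtain j where j: "j \<in> {1..N}" "code_exponent K i (\<sigma> i) = code_exponent K j (\<rho> j)"
      by blast
    have "\<sigma> i \<in> {1..K}" "\<rho> j \<in> {1..K}"
      using \<sigma> \<rho> i j(1) by (auto simp: labelings_def PiE_iff)
    then show "\<sigma> i = \<rho> i"
      using code_exponent_inject[of i j "\<sigma> i" K "\<rho> j"] i j by auto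
  qed
qed

text \<open>Labels start at 1, so no exponent is 0. Evenness raises the gap between distinct codes
  from 1 to 2, the source of the factor 2 in the final bound.\<close>

lemma even_labeling_code:
  assumes "\<sigma> \<in> labelings N K"
  shows "even (labeling_code N K \<sigma>)"
  unfolding labeling_code_def
proof (rule dvd_sum)
  fix i assume "i \<in> {1..N}"
  then have "\<sigma> i \<ge> 1"
    using assms by (auto simp: labelings_def PiE_iff)
  then show "even (2 ^ code_exponent K i (\<sigma> i) :: nat)"
    by (auto simp: code_exponent_def)
qed

lemma labeling_code_gap:
  assumes "\<sigma> \<in> labelings N K" "\<rho> \<in> labelings N K" "\<sigma> \<noteq> \<rho>"
  shows "2 \<le> \<bar>real (labeling_code N K \<sigma>) - real (labeling_code N K \<rho>)\<bar>"
proof -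
  have "labeling_code N K \<sigma> \<noteq> labeling_code N K \<rho>"
    using assms inj_on_labeling_code by (metis inj_onD)
  moreover obtain a b where "labeling_code N K \<sigma> = 2 * a" "labeling_code N K \<rho> = 2 * b"
    using assms by (metis even_labeling_code evenE)
  ultimately show ?thesis by simp
qed

lemma finite_labelings: "finite (labelings N K)"
  by (simp add: labelings_def finite_PiE)

lemma min_gap_ge:
  assumes "N \<ge> 1" "K \<ge> 2"
    and gap: "\<And>\<sigma> \<rho>. \<sigma> \<in> labelings N K \<Longrightarrow> \<rho> \<in> labelings N K \<Longrightarrow> \<sigma> \<noteq> \<rho> \<Longrightarrow> t \<le> \<bar>f \<sigma> \<theta> - f \<rho> \<theta>\<bar>"
  shows "t \<le> min_gap N K f \<theta>"
proof -
  let ?G = "{\<bar>f \<sigma> \<theta> - f \<rho> \<theta>\<bar> | \<sigma> \<rho>. \<sigma> \<in> labelings N K \<and> \<rho> \<in> labelings N K \<and> \<sigma> \<noteq> \<rho>}"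
  have "?G \<subseteq> (\<lambda>(\<sigma>, \<rho>). \<bar>f \<sigma> \<theta> - f \<rho> \<theta>\<bar>) ` (labelings N K \<times> labelings N K)"
    by auto
  then have fin: "finite ?G"
    by (rule finite_subset) (simp add: finite_labelings)
  \<comment> \<open>Two constant labelings show that the set of gaps is nonempty, without which its
    \<open>Min\<close> would be unspecified. Label 2 is available by \<open>K \<ge> 2\<close>, and
    the two differ at row 1 by \<open>N \<ge> 1\<close>.\<close>
  let ?\<sigma> = "restrict (\<lambda>_. 1) {1..N} :: nat \<Rightarrow> nat" and ?\<rho> = "restrict (\<lambda>_. 2) {1..N} :: nat \<Rightarrow> nat"
  have "?\<sigma> \<in> labelings N K" "?\<rho> \<in> labelings N K"
    using assms by (auto simp: labelings_def)
  moreover have "?\<sigma> 1 \<noteq> ?\<rho> 1"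
    using \<open>N \<ge> 1\<close> by simp
  then have "?\<sigma> \<noteq> ?\<rho>"
    by metis
  ultimately have "?G \<noteq> {}"
    by blast
  then show ?thesis
    unfolding min_gap_def using fin gap by (auto intro!: Min.boundedI)
qed

lemma row_normalize_in_prob_matrices:
  assumes "K \<ge> 2" and pos: "\<And>n k. 0 < v n k"
  shows "row_normalize K v \<in> prob_matrices N K"
proof -
  have total_pos: "0 < (\<Sum>j=1..K. v n j)" for n
    using assms by (intro sum_pos) auto
  have "v n k < (\<Sum>j=1..K. v n j)" if "k \<in> {1..K}" for n k
  proof -
    \<comment> \<open>As \<open>K \<ge> 2\<close>, each row has a positive entry besides the one at
      \<open>k\<close>; hence the normalized entry is strictly below 1.\<close>
    have "0 < (\<Sum>j\<in>{1..K} - {k}. v n j)"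
    proof (rule sum_pos)
      show "{1..K} - {k} \<noteq> {}"
      proof -
        have "1 \<in> {1..K}" "2 \<in> {1..K}" "(1::nat) \<noteq> 2"
          using \<open>K \<ge> 2\<close> by auto
        then show ?thesis
          by blast
      qed
    qed (use pos in auto)
    then show ?thesis
      using sum.remove[OF finite_atLeastAtMost that, of "v n"] by linarith
  qed
  moreover have "(\<Sum>k=1..K. row_normalize K v n k) = 1" for n
    using total_pos[of n] by (simp add: row_normalize_def flip: sum_divide_distrib)
  ultimately show ?thesis
    using pos total_pos by (auto simp: prob_matrices_def row_normalize_def)
qed

lemma CEloss_labeling:
  assumes "\<sigma> \<in> labelings N K"
  shows "CEloss N K \<sigma> \<theta> = - (1 / real N) * (\<Sum>i=1..N. ln (\<theta> i (\<sigma> i)))"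
proof -
  have "(\<Sum>k=1..K. of_bool (\<sigma> i = k) * ln (\<theta> i k)) = ln (\<theta> i (\<sigma> i))" if "i \<in> {1..N}" for i
  proof -
    have "\<sigma> i \<in> {1..K}"
      using assms that by (auto simp: labelings_def PiE_iff)
    then show ?thesis
      by (simp add: of_bool_def if_distrib[of "\<lambda>x. x * _"] cong: if_cong)
  qed
  then show ?thesis
    by (simp add: CEloss_def)
qed

text \<open>The logarithm splits each entry into its exponent times \<open>ln 3\<close> and the
  normalizer of its row. The normalizers do not depend on the labeling, so the loss is affine in
  \<open>labeling_code\<close>. The scale \<open>c\<close> allows both cases of the theorem to be
  treated at once.\<close>

lemma CEloss_row_normalize_powr:
  fixes c :: real
  assumes \<sigma>: "\<sigma> \<in> labelings N K" and "K \<ge> 2"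
  defines "v \<equiv> \<lambda>n k. 3 powr (2 ^ code_exponent K n k * c)"
  shows "CEloss N K \<sigma> (row_normalize K v) =
    (\<Sum>i=1..N. ln (\<Sum>j=1..K. v i j)) / N - c * ln 3 / N * labeling_code N K \<sigma>"
proof -
  have "(\<Sum>j=1..K. v i j) > 0" for i
    using \<open>K \<ge> 2\<close> by (intro sum_pos) (auto simp: v_def)
  then have "(\<Sum>j=1..K. v i j) \<noteq> 0" for i
    by (metis less_irrefl)
  moreover have "v i k \<noteq> 0" "ln (v i k) = c * ln 3 * 2 ^ code_exponent K i k" for i k
    by (simp_all add: v_def ln_powr)
  ultimately have "ln (row_normalize K v i k) =
      c * ln 3 * 2 ^ code_exponent K i k - ln (\<Sum>j=1..K. v i j)" for i k
    by (simp add: row_normalize_def ln_div)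
  then show ?thesis
    by (simp add: CEloss_labeling[OF \<sigma>] labeling_code_def sum_subtractf diff_divide_distrib
        flip: sum_distrib_left)
qed

lemma min_gap_CEloss_ge:
  fixes c :: real
  assumes "N \<ge> 1" "K \<ge> 2" "c > 0"
  shows "2 * c / N \<le> min_gap N K (CEloss N K)
    (row_normalize K (\<lambda>n k. 3 powr (2 ^ code_exponent K n k * c)))"
proof (rule min_gap_ge[OF \<open>N \<ge> 1\<close> \<open>K \<ge> 2\<close>])
  fix \<sigma> \<rho>
  assume \<sigma>: "\<sigma> \<in> labelings N K" and \<rho>: "\<rho> \<in> labelings N K" and "\<sigma> \<noteq> \<rho>"
  let ?\<theta> = "row_normalize K (\<lambda>n k. 3 powr (2 ^ code_exponent K n k * c))"
  let ?d = "real (labeling_code N K \<sigma>) - real (labeling_code N K \<rho>)"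
  have "CEloss N K \<sigma> ?\<theta> - CEloss N K \<rho> ?\<theta> = - (c * ln 3 / N * ?d)"
    by (simp add: CEloss_row_normalize_powr \<sigma> \<rho> \<open>K \<ge> 2\<close> right_diff_distrib)
  then have diff: "\<bar>CEloss N K \<sigma> ?\<theta> - CEloss N K \<rho> ?\<theta>\<bar> = c * ln 3 / N * \<bar>?d\<bar>"
    using \<open>c > 0\<close> by (simp add: abs_mult)
  have "exp 1 \<le> (3::real)"
    by (rule exp_le)
  then have "1 \<le> ln (3::real)"
    by (simp add: ln_ge_iff)
  then have "c / N \<le> c * ln 3 / N"
    using \<open>c > 0\<close> by (intro divide_right_mono) auto
  then have "c / N * 2 \<le> c * ln 3 / N * \<bar>?d\<bar>"
    using \<open>c > 0\<close> labeling_code_gap[OF \<sigma> \<rho> \<open>\<sigma> \<noteq> \<rho>\<close>] by (intro mult_mono) auto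
  then show "2 * c / N \<le> \<bar>CEloss N K \<sigma> ?\<theta> - CEloss N K \<rho> ?\<theta>\<bar>"
    unfolding diff by (simp add: mult.commute)
qed

theorem theorem3:
  fixes N K :: nat
  assumes "N \<ge> 1" and "K \<ge> 2"
  shows "(\<forall>\<tau>::real. \<tau> > 0 \<longrightarrow>
            codomain_separable (2 * \<tau>) N K (CEloss N K)
              (row_normalize K (\<lambda>n k. 3 powr (2 ^ ((n - 1) * K + k) * real N * \<tau>)))) \<and>
         zero_plus_codomain_separable N K (CEloss N K)
           (row_normalize K (\<lambda>n k. 3 ^ (2 ^ ((n - 1) * K + k))))"
proof (intro conjI allI impI)
  fix \<tau> :: real
  assume "\<tau> > 0"
  then show "codomain_separable (2 * \<tau>) N K (CEloss N K)
      (row_normalize K (\<lambda>n k. 3 powr (2 ^ ((n - 1) * K + k) * real N * \<tau>)))"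
    \<comment> \<open>With \<open>c = N * \<tau>\<close> the averaging factor \<open>1 / N\<close>
      of the loss cancels, leaving exactly \<open>2 * \<tau>\<close>.\<close>
    using min_gap_CEloss_ge[of N K "real N * \<tau>"] assms
    by (simp add: codomain_separable_def row_normalize_in_prob_matrices code_exponent_def
        mult.assoc)
next
  \<comment> \<open>The natural-number power is the case \<open>c = 1\<close> of the
    \<open>powr\<close> form; the bound becomes \<open>2 / N\<close>, which is positive.\<close>
  have "(3::real) ^ (2 ^ m) = 3 powr (2 ^ m * 1)" for m :: nat
    using powr_realpow[of 3 "2 ^ m"] by simp
  moreover have "0 < 2 * 1 / real N"
    using assms by simp
  ultimately show "zero_plus_codomain_separable N K (CEloss N K)
      (row_normalize K (\<lambda>n k. 3 ^ (2 ^ ((n - 1) * K + k))))"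
    using min_gap_CEloss_ge[of N K 1] assms
    by (simp add: zero_plus_codomain_separable_def row_normalize_in_prob_matrices
        code_exponent_def less_le_trans[of 0 "2 / real N"])
qed

end
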